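(* Let $\alpha\in\mathbb{C}$ and $H_4(q,p,t;\alpha)=\dfrac{q^2p^2+\alpha qp}{2t}$. The system $$\frac{dq}{dt}=\frac{\partial H_4}{\partial p},\qquad \frac{dp}{dt}=-\frac{\partial H_4}{\partial q}$$ has the first integral $I_4=qp$.
   Context: A first integral is a function of $(q,p)$ that is constant along every solution of the system. *)

theory Defs
  imports "HOL-Complex_Analysis.Complex_Analysis"
begin

definition H4 :: "complex \<Rightarrow> complex \<Rightarrow> complex \<Rightarrow> complex \<Rightarrow> complex" where
  "H4 \<alpha> q p t = (q^2 * p^2 + \<alpha> * q * p) / (2 * t)"

text \<open>The set \<open>T\<close> below is the set of times at which the Hamiltonian \<open>H\<close> is defined; it has to be
  recorded separately because division is total. A solution lives on a domain (open connected
  set) \<open>D \<subseteq> T\<close>, so that a multivalued solution is represented by its local branches.\<close>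

definition hamiltonian_solution ::
  "complex set \<Rightarrow> (complex \<Rightarrow> complex \<Rightarrow> complex \<Rightarrow> complex) \<Rightarrow> complex set
    \<Rightarrow> (complex \<Rightarrow> complex) \<Rightarrow> (complex \<Rightarrow> complex) \<Rightarrow> bool" where
  "hamiltonian_solution T H D q p \<longleftrightarrow>
     open D \<and> connected D \<and> D \<subseteq> T \<and>
     (\<forall>t\<in>D. (q has_field_derivative deriv (\<lambda>y. H (q t) y t) (p t)) (at t) \<and>
            (p has_field_derivative - deriv (\<lambda>x. H x (p t) t) (q t)) (at t))"

definition first_integral ::
  "complex set \<Rightarrow> (complex \<Rightarrow> complex \<Rightarrow> complex \<Rightarrow> complex)
    \<Rightarrow> (complex \<Rightarrow> complex \<Rightarrow> complex) \<Rightarrow> bool" where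
  "first_integral T H I \<longleftrightarrow>
     (\<forall>D q p. hamiltonian_solution T H D q p \<longrightarrow> (\<lambda>t. I (q t) (p t)) constant_on D)"

end

theory Submission
  imports Defs
begin

text \<open>The Hamiltonian depends on \<open>q\<close> and \<open>p\<close> only through the product \<open>q * p\<close>, so it is invariant
  under the scaling \<open>(q, p) \<mapsto> (c * q, p / c)\<close>, and this product is the conserved quantity which
  belongs to that symmetry. Concretely, if \<open>H = h t (q * p)\<close> and \<open>h'\<close> is the derivative of \<open>h t\<close>
  at \<open>q * p\<close>, the equations of motion are \<open>dq/dt = h' * q\<close> and \<open>dp/dt = - h' * p\<close>, and the two
  terms of the product rule for \<open>q * p\<close> cancel. A function with zero derivative on a connected
  open set is constant. The explicit time dependence of \<open>H\<close> is harmless: time is a mere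
  parameter in the two partial derivatives.\<close>

text \<open>The chain rule turns both partial derivatives of \<open>H\<close> into multiples of the same number
  \<open>deriv (h t) (q t * p t)\<close>; the opposite signs in the two equations of motion then make the
  logarithmic growth rates of \<open>q\<close> and \<open>p\<close> opposite.\<close>

lemma first_integral_product:
  assumes H: "\<And>x y t. t \<in> T \<Longrightarrow> H x y t = h t (x * y)"
    and h: "\<And>t z. t \<in> T \<Longrightarrow> h t field_differentiable at z"
  shows "first_integral T H (\<lambda>q p. q * p)"
  unfolding first_integral_def
proof (intro allI impI)
  fix D q p
  assume "hamiltonian_solution T H D q p"
  then have D: "open D" "connected D" "D \<subseteq> T"
    and q: "\<And>t. t \<in> D \<Longrightarrow> (q has_field_derivative deriv (\<lambda>y. H (q t) y t) (p t)) (at t)"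
    and p: "\<And>t. t \<in> D \<Longrightarrow> (p has_field_derivative - deriv (\<lambda>x. H x (p t) t) (q t)) (at t)"
    unfolding hamiltonian_solution_def by auto
  have deriv_zero: "((\<lambda>t. q t * p t) has_field_derivative 0) (at t)" if t: "t \<in> D" for t
  proof -
    define h' where "h' = deriv (h t) (q t * p t)"
    have tT: "t \<in> T" using t D by blast
    have h': "(h t has_field_derivative h') (at (q t * p t))"
      unfolding h'_def using h[OF tT] by (simp add: field_differentiable_derivI)
    have "((\<lambda>y. h t (q t * y)) has_field_derivative h' * q t) (at (p t))"
      by (rule DERIV_chain2[where f = "h t" and g = "\<lambda>y. q t * y", OF h']) (auto intro!: derivative_eq_intros)
    then have "deriv (\<lambda>y. H (q t) y t) (p t) = h' * q t"
      by (simp add: H[OF tT] DERIV_imp_deriv)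
    moreover have "((\<lambda>x. h t (x * p t)) has_field_derivative h' * p t) (at (q t))"
      by (rule DERIV_chain2[where f = "h t" and g = "\<lambda>x. x * p t", OF h']) (auto intro!: derivative_eq_intros)
    then have "deriv (\<lambda>x. H x (p t) t) (q t) = h' * p t"
      by (simp add: H[OF tT] DERIV_imp_deriv)
    ultimately show ?thesis
      using DERIV_mult[OF q[OF t] p[OF t]] by (simp add: algebra_simps)
  qed
  have "continuous_on D (\<lambda>t. q t * p t)"
    by (rule DERIV_continuous_on) (rule has_field_derivative_at_within[OF deriv_zero])
  then obtain c where "\<And>t. t \<in> D \<Longrightarrow> q t * p t = c"
    using DERIV_zero_connected_constant[OF D(2,1) finite.emptyI, of "\<lambda>t. q t * p t"]
      deriv_zero by auto
  then show "(\<lambda>t. q t * p t) constant_on D"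
    unfolding constant_on_def by blast
qed

theorem proposition4p2:
  fixes \<alpha> :: complex
  shows "first_integral (- {0}) (H4 \<alpha>) (\<lambda>q p. q * p)"
proof (rule first_integral_product)
  show "H4 \<alpha> x y t = (\<lambda>z. (z^2 + \<alpha> * z) / (2 * t)) (x * y)" for x y t
    by (simp add: H4_def power_mult_distrib mult.assoc)
  show "(\<lambda>z. (z^2 + \<alpha> * z) / (2 * t)) field_differentiable at z" if "t \<in> - {0}" for t z
    using that by (intro derivative_intros) auto
qed

end
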